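(* Let $v:\mathbb{R}^2\to\mathbb{R}^2$ be a periodic vector field of class $C^2(\mathbb{R}^2)$ solving, with some pressure $p\in C^1(\mathbb{R}^2,\mathbb{R})$, the stationary incompressible Euler equations $v\cdot\nabla v+\nabla p=0$ and $\operatorname{div} v=0$ in $\mathbb{R}^2$. If $|v(x)|\neq0$ for all $x\in\mathbb{R}^2$, then $v$ is a shear flow.
   Context: A flow $v$ is periodic if there is a basis $(\mathrm{e}_1,\mathrm{e}_2)$ of $\mathbb{R}^2$ such that $v(x)=v(x+k_1\mathrm{e}_1+k_2\mathrm{e}_2)$ for all $x\in\mathbb{R}^2$ and $(k_1,k_2)\in\mathbb{Z}^2$. Solutions are classical. A flow $v$ is a shear flow if there is a unit vector $e=(e_1,e_2)\in\mathbb{R}^2$ such that $v$ is parallel to $e$ everywhere; for a divergence-free flow this means that $v(x)=V(x\cdot e^\perp)\,e$ for all $x\in\mathbb{R}^2$ and some function $V:\mathbb{R}\to\mathbb{R}$, with $e^\perp=(-e_2,e_1)$. *)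

theory Defs
  imports "HOL-Analysis.Analysis"
begin

definition partial_deriv :: "'n::finite \<Rightarrow> (real^'n \<Rightarrow> 'b::real_normed_vector) \<Rightarrow> real^'n \<Rightarrow> 'b" where
  "partial_deriv i f x = frechet_derivative f (at x) (axis i 1)"

text \<open>Class \<open>C\<^sup>k\<close> on the whole space. Differentiability is required explicitly because
  \<open>frechet_derivative\<close> has an unspecified value at points of non-differentiability.\<close>

primrec class_C :: "nat \<Rightarrow> (real^'n::finite \<Rightarrow> 'b::real_normed_vector) \<Rightarrow> bool" where
  "class_C 0 f \<longleftrightarrow> continuous_on UNIV f"
| "class_C (Suc k) f \<longleftrightarrow> (\<forall>x. f differentiable (at x)) \<and> (\<forall>i. class_C k (partial_deriv i f))"

definition grad :: "(real^'n::finite \<Rightarrow> real) \<Rightarrow> real^'n \<Rightarrow> real^'n" where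
  "grad p x = (\<chi> i. partial_deriv i p x)"

definition divergence :: "(real^'n::finite \<Rightarrow> real^'n) \<Rightarrow> real^'n \<Rightarrow> real" where
  "divergence v x = (\<Sum>i\<in>UNIV. partial_deriv i v x $ i)"

text \<open>The convective term \<open>v \<cdot> \<nabla>v\<close>, i.e. \<open>\<Sum>\<^sub>i v\<^sub>i \<partial>\<^sub>i v\<close>.\<close>

definition convective :: "(real^'n::finite \<Rightarrow> real^'n) \<Rightarrow> real^'n \<Rightarrow> real^'n" where
  "convective v x = (\<Sum>i\<in>UNIV. (v x $ i) *\<^sub>R partial_deriv i v x)"

definition stationary_euler :: "(real^'n::finite \<Rightarrow> real^'n) \<Rightarrow> (real^'n \<Rightarrow> real) \<Rightarrow> bool" where
  "stationary_euler v p \<longleftrightarrow> (\<forall>x. convective v x + grad p x = 0) \<and> (\<forall>x. divergence v x = 0)"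

text \<open>The condition \<open>e1 \<noteq> e2\<close> is needed since \<open>{e1, e2}\<close> is a set.\<close>

definition periodic_flow :: "(real^2 \<Rightarrow> real^2) \<Rightarrow> bool" where
  "periodic_flow v \<longleftrightarrow>
    (\<exists>e1 e2. e1 \<noteq> e2 \<and> independent {e1, e2} \<and> span {e1, e2} = UNIV \<and>
      (\<forall>x. \<forall>k1 k2 :: int. v x = v (x + of_int k1 *\<^sub>R e1 + of_int k2 *\<^sub>R e2)))"

definition shear_flow :: "(real^2 \<Rightarrow> real^2) \<Rightarrow> bool" where
  "shear_flow v \<longleftrightarrow> (\<exists>e. norm e = 1 \<and> (\<forall>x. \<exists>c::real. v x = c *\<^sub>R e))"

definition perp :: "real^2 \<Rightarrow> real^2" where
  "perp e = vector [- e $ 2, e $ 1]"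

lemma shear_flow_iff_profile:
  fixes v :: "real^2 \<Rightarrow> real^2"
  assumes diff: "\<And>x. v differentiable (at x)" and div: "\<And>x. divergence v x = 0"
  shows "shear_flow v \<longleftrightarrow>
    (\<exists>e V. norm e = 1 \<and> (\<forall>x. v x = (V (x \<bullet> perp e) :: real) *\<^sub>R e))"
proof
  assume "shear_flow v"
  then obtain e where e: "norm e = 1" and "\<forall>x. \<exists>c::real. v x = c *\<^sub>R e"
    unfolding shear_flow_def by blast
  then obtain c where c: "\<And>x. v x = (c x :: real) *\<^sub>R e" by metis
  have v_eq: "v = (\<lambda>x. c x *\<^sub>R e)" using c by auto
  have ee: "e \<bullet> e = 1" using e by (simp add: dot_square_norm)
  have "c x = v x \<bullet> e" for x unfolding c[of x] by (simp add: ee)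
  then have c_eq: "c = (\<lambda>x. v x \<bullet> e)" by auto
  have dv: "(v has_derivative frechet_derivative v (at x)) (at x)" for x
    using diff frechet_derivative_works by blast
  define c' where "c' = (\<lambda>x h. frechet_derivative v (at x) h \<bullet> e)"
  have dc: "(c has_derivative c' x) (at x)" for x
    unfolding c_eq c'_def by (intro has_derivative_inner_left dv)
  have dv_eq: "frechet_derivative v (at x) = (\<lambda>h. c' x h *\<^sub>R e)" for x
  proof -
    have "(v has_derivative (\<lambda>h. c' x h *\<^sub>R e)) (at x)"
      using has_derivative_scaleR_left[OF dc[of x], of e] unfolding v_eq[symmetric] .
    then show ?thesis by (rule frechet_derivative_at[symmetric])
  qed
  have "c' x e = 0" for x
  proof -
    have lin: "linear (c' x)" using dc has_derivative_linear by blast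
    have "e = (e$1) *\<^sub>R axis 1 1 + (e$2) *\<^sub>R axis 2 1"
      by (simp add: vec_eq_iff forall_2 axis_def)
    then have "c' x e = c' x ((e$1) *\<^sub>R axis 1 1 + (e$2) *\<^sub>R axis 2 1)"
      by (rule arg_cong)
    also have "\<dots> = (e$1) * c' x (axis 1 1) + (e$2) * c' x (axis 2 1)"
      by (simp add: linear_add[OF lin] linear_scale[OF lin])
    also have "\<dots> = divergence v x"
      unfolding divergence_def partial_deriv_def sum_2 dv_eq by (simp add: mult.commute)
    finally show ?thesis using div by simp
  qed
  moreover have "((\<lambda>t. c (y + t *\<^sub>R e)) has_derivative (\<lambda>h. c' (y + t *\<^sub>R e) (h *\<^sub>R e))) (at t)"
    for y t
    by (rule has_derivative_compose[OF _ dc]) (auto intro!: derivative_eq_intros)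
  moreover have "c' x (h *\<^sub>R e) = h * c' x e" for x h
    using linear_scale[OF has_derivative_linear[OF dc[of x]], of h e] by simp
  ultimately have "((\<lambda>t. c (y + t *\<^sub>R e)) has_derivative (\<lambda>h. 0)) (at t)" for y t
    by simp
  then have const: "c (y + t *\<^sub>R e) = c (y + s *\<^sub>R e)" for y t s
    using has_derivative_zero_constant[of UNIV "\<lambda>t. c (y + t *\<^sub>R e)"] by (metis UNIV_I convex_UNIV)
  have "x = (x \<bullet> perp e) *\<^sub>R perp e + (x \<bullet> e) *\<^sub>R e" for x
  proof -
    have 1: "(e$1)^2 + (e$2)^2 = 1"
      using ee by (simp add: inner_vec_def sum_2 power2_eq_square)
    have "x$1 = x$1 * ((e$1)^2 + (e$2)^2)" "x$2 = x$2 * ((e$1)^2 + (e$2)^2)"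
      unfolding 1 by simp_all
    then show ?thesis
      by (simp add: vec_eq_iff forall_2 perp_def inner_vec_def sum_2 power2_eq_square algebra_simps)
  qed
  then have "c x = c ((x \<bullet> perp e) *\<^sub>R perp e)" for x
    using const[of "(x \<bullet> perp e) *\<^sub>R perp e" "x \<bullet> e" 0] by (metis add.right_neutral scaleR_zero_left)
  then have "\<forall>x. v x = c ((x \<bullet> perp e) *\<^sub>R perp e) *\<^sub>R e"
    using c by metis
  then show "\<exists>e V. norm e = 1 \<and> (\<forall>x. v x = (V (x \<bullet> perp e) :: real) *\<^sub>R e)"
    using e by (intro exI[of _ e] exI[of _ "\<lambda>s. c (s *\<^sub>R perp e)"]) simp
next
  assume "\<exists>e V. norm e = 1 \<and> (\<forall>x. v x = (V (x \<bullet> perp e) :: real) *\<^sub>R e)"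
  then show "shear_flow v" unfolding shear_flow_def by blast
qed

end

theory Submission
  imports Defs
begin

text \<open>
  Write \<open>v = \<bar>v\<bar> (cos \<phi>, sin \<phi>)\<close> locally, and let \<open>\<partial>\<^sub>1, \<partial>\<^sub>2\<close> be the partial derivatives. A field of
  constant direction is one with \<open>\<nabla>\<phi> = 0\<close>. The angle \<open>\<phi>\<close> need not descend to the torus \<open>\<real>\<^sup>2\<close> modulo the
  lattice, but its gradient \<open>g = (v\<^sub>1 \<nabla>v\<^sub>2 - v\<^sub>2 \<nabla>v\<^sub>1) / \<bar>v\<bar>\<^sup>2\<close> is globally defined, periodic, of class
  \<open>C\<^sup>1\<close> and curl free (lemma \<open>angle_deriv_curl_free\<close>).

  The proof rests on a link between this angle and the pressure. Since \<open>\<partial>\<^sub>1v\<^sub>1 + \<partial>\<^sub>2v\<^sub>2 = 0\<close>,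
  the numerator \<open>v\<^sub>1 \<partial>\<^sub>1v\<^sub>2 - v\<^sub>2 \<partial>\<^sub>1v\<^sub>1\<close> is the second component of \<open>v \<cdot> \<nabla>v\<close>, hence \<open>-\<partial>\<^sub>2p\<close>, and
  likewise \<open>v\<^sub>1 \<partial>\<^sub>2v\<^sub>2 - v\<^sub>2 \<partial>\<^sub>2v\<^sub>1 = \<partial>\<^sub>1p\<close>. So \<open>\<bar>v\<bar>\<^sup>2 g = (-\<partial>\<^sub>2p, \<partial>\<^sub>1p)\<close> (lemma \<open>angle_deriv_euler\<close>).

  The pressure itself is periodic (lemma \<open>pressure_periodic\<close>): its gradient is periodic, so \<open>p\<close> grows by
  a constant along each period, and these constants are read off from the mean of \<open>\<nabla>p\<close> over a
  period cell. That mean vanishes because \<open>\<nabla>p = - div (v \<otimes> v)\<close> is made of derivatives of periodic functions.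

  Combining these facts,
  \<open>\<bar>v\<bar>\<^sup>2 \<bar>g\<bar>\<^sup>2 = g\<^sub>2 \<partial>\<^sub>1p - g\<^sub>1 \<partial>\<^sub>2p = \<partial>\<^sub>1(p g\<^sub>2) - \<partial>\<^sub>2(p g\<^sub>1)\<close>,
  where the terms with \<open>p\<close> undifferentiated cancel as \<open>g\<close> is curl free. The right-hand side has mean
  zero over a period cell and the left-hand side is nonnegative, so \<open>g = 0\<close> (lemma \<open>angle_deriv_zero\<close>).
\<close>

section \<open>Partial derivatives and functions of class C1\<close>

lemma partial_deriv_eqI:
  assumes "(f has_derivative f') (at x)"
  shows "partial_deriv i f x = f' (axis i 1)"
  unfolding partial_deriv_def frechet_derivative_at[OF assms, symmetric] ..

lemma frechet_derivative_eq_sum_partial_deriv: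
  fixes f :: "real^'n::finite \<Rightarrow> 'b::real_normed_vector"
  assumes "f differentiable (at x)"
  shows "frechet_derivative f (at x) w = (\<Sum>i\<in>UNIV. (w $ i) *\<^sub>R partial_deriv i f x)"
proof -
  have lin: "linear (frechet_derivative f (at x))"
    by (rule linear_frechet_derivative[OF assms])
  have "frechet_derivative f (at x) w
      = frechet_derivative f (at x) (\<Sum>i\<in>UNIV. (w $ i) *\<^sub>R axis i 1)"
    using basis_expansion[of w] by (simp add: scalar_mult_eq_scaleR)
  then show ?thesis
    by (simp add: partial_deriv_def linear_sum[OF lin] linear_scale[OF lin])
qed

lemma class_C_1_iff:
  "class_C 1 f \<longleftrightarrow> (\<forall>x. f differentiable (at x)) \<and> (\<forall>i. continuous_on UNIV (partial_deriv i f))"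
  by simp

lemma class_C_2_iff:
  "class_C 2 f \<longleftrightarrow> (\<forall>x. f differentiable (at x)) \<and> (\<forall>i. class_C 1 (partial_deriv i f))"
  by (simp add: numeral_2_eq_2)

lemma continuous_on_if_differentiable:
  assumes "\<And>x. f differentiable (at x)"
  shows "continuous_on S f"
  using assms differentiable_imp_continuous_within
  by (intro continuous_at_imp_continuous_on) blast

lemma class_C_1I:
  assumes "\<And>x. f differentiable (at x)" "\<And>i x. partial_deriv i f x = f' i x"
    and "\<And>i. continuous_on UNIV (f' i)"
  shows "class_C 1 f"
proof -
  have "partial_deriv i f = f' i" for i
    by (rule ext) (rule assms(2))
  then show ?thesis
    unfolding class_C_1_iff using assms(1,3) by simp
qed

lemma class_C_1_if_class_C_2: "class_C 2 f \<Longrightarrow> class_C 1 f"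
  unfolding class_C_1_iff class_C_2_iff using continuous_on_if_differentiable by blast

lemma class_C_1_continuous_on: "class_C 1 f \<Longrightarrow> continuous_on S f"
  unfolding class_C_1_iff using continuous_on_if_differentiable by blast

lemma class_C_1_partial_deriv_continuous_on: "class_C 1 f \<Longrightarrow> continuous_on S (partial_deriv i f)"
  unfolding class_C_1_iff using continuous_on_subset by blast

lemma class_C_1_directional_continuous_on:
  assumes "class_C 1 f"
  shows "continuous_on S (\<lambda>x. frechet_derivative f (at x) w)"
proof -
  have eq: "(\<lambda>x. frechet_derivative f (at x) w) = (\<lambda>x. \<Sum>i\<in>UNIV. (w $ i) *\<^sub>R partial_deriv i f x)"
    using assms unfolding class_C_1_iff
    by (intro ext frechet_derivative_eq_sum_partial_deriv) blast
  show ?thesis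
    unfolding eq by (intro continuous_intros class_C_1_partial_deriv_continuous_on[OF assms])
qed

lemma partial_deriv_diff:
  assumes "f differentiable (at x)" "g differentiable (at x)"
  shows "partial_deriv i (\<lambda>x. f x - g x) x = partial_deriv i f x - partial_deriv i g x"
  using assms unfolding frechet_derivative_works
  by (subst partial_deriv_eqI[OF has_derivative_diff]) (auto simp: partial_deriv_def)

lemma partial_deriv_add:
  assumes "f differentiable (at x)" "g differentiable (at x)"
  shows "partial_deriv i (\<lambda>x. f x + g x) x = partial_deriv i f x + partial_deriv i g x"
  using assms unfolding frechet_derivative_works
  by (subst partial_deriv_eqI[OF has_derivative_add]) (auto simp: partial_deriv_def)

lemma partial_deriv_mult:
  fixes f g :: "real^'n::finite \<Rightarrow> real"
  assumes "f differentiable (at x)" "g differentiable (at x)"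
  shows "partial_deriv i (\<lambda>x. f x * g x) x = f x * partial_deriv i g x + partial_deriv i f x * g x"
  using assms unfolding frechet_derivative_works
  by (subst partial_deriv_eqI[OF has_derivative_mult]) (auto simp: partial_deriv_def)

lemma partial_deriv_divide:
  fixes f g :: "real^'n::finite \<Rightarrow> real"
  assumes "f differentiable (at x)" "g differentiable (at x)" "g x \<noteq> 0"
  shows "partial_deriv i (\<lambda>x. f x / g x) x
    = (partial_deriv i f x * g x - f x * partial_deriv i g x) / (g x * g x)"
  using assms unfolding frechet_derivative_works
  by (subst partial_deriv_eqI[OF has_derivative_divide']) (auto simp: partial_deriv_def)

lemma partial_deriv_component:
  fixes f :: "real^'n::finite \<Rightarrow> real^'m::finite"
  assumes "f differentiable (at x)"
  shows "partial_deriv i (\<lambda>x. f x $ k) x = partial_deriv i f x $ k"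
  using assms unfolding frechet_derivative_works
  by (subst partial_deriv_eqI[OF bounded_linear.has_derivative[OF bounded_linear_vec_nth]])
    (auto simp: partial_deriv_def)

lemma differentiable_component:
  fixes f :: "real^'n::finite \<Rightarrow> real^'m::finite"
  assumes "f differentiable (at x)"
  shows "(\<lambda>x. f x $ k) differentiable (at x)"
proof -
  obtain f' where f': "(f has_derivative f') (at x)"
    using assms unfolding differentiable_def ..
  show ?thesis
    by (rule differentiableI[OF bounded_linear.has_derivative[OF bounded_linear_vec_nth f']])
qed

lemma class_C_1_component:
  fixes f :: "real^'n::finite \<Rightarrow> real^'m::finite"
  assumes "class_C 1 f"
  shows "class_C 1 (\<lambda>x. f x $ k)"
  using assms unfolding class_C_1_iff[of f]
  by (intro class_C_1I[OF _ partial_deriv_component]) (auto intro!: differentiable_component continuous_intros)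

lemma class_C_1_diff:
  assumes "class_C 1 f" "class_C 1 g"
  shows "class_C 1 (\<lambda>x. f x - g x)"
  using assms unfolding class_C_1_iff[of f] class_C_1_iff[of g]
  by (intro class_C_1I[OF _ partial_deriv_diff]) (auto intro!: continuous_intros)

lemma class_C_1_add:
  assumes "class_C 1 f" "class_C 1 g"
  shows "class_C 1 (\<lambda>x. f x + g x)"
  using assms unfolding class_C_1_iff[of f] class_C_1_iff[of g]
  by (intro class_C_1I[OF _ partial_deriv_add]) (auto intro!: continuous_intros)

lemma class_C_1_mult:
  fixes f g :: "real^'n::finite \<Rightarrow> real"
  assumes "class_C 1 f" "class_C 1 g"
  shows "class_C 1 (\<lambda>x. f x * g x)"
  using assms class_C_1_continuous_on[OF assms(1)] class_C_1_continuous_on[OF assms(2)]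
  unfolding class_C_1_iff[of f] class_C_1_iff[of g]
  by (intro class_C_1I[OF _ partial_deriv_mult]) (auto intro!: continuous_intros)

lemma class_C_1_divide:
  fixes f g :: "real^'n::finite \<Rightarrow> real"
  assumes "class_C 1 f" "class_C 1 g" "\<And>x. g x \<noteq> 0"
  shows "class_C 1 (\<lambda>x. f x / g x)"
  using assms class_C_1_continuous_on[OF assms(1)] class_C_1_continuous_on[OF assms(2)]
  unfolding class_C_1_iff[of f] class_C_1_iff[of g]
  by (intro class_C_1I[OF _ partial_deriv_divide]) (auto intro!: continuous_intros)

lemma
  assumes "f differentiable (at (x + e))"
  shows differentiable_shift: "(\<lambda>y. f (y + e)) differentiable (at x)"
    and partial_deriv_shift: "partial_deriv i (\<lambda>y. f (y + e)) x = partial_deriv i f (x + e)"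
proof -
  have f: "(f has_derivative frechet_derivative f (at (x + e))) (at (x + e))"
    using assms frechet_derivative_works by blast
  have "((\<lambda>y. y + e) has_derivative (\<lambda>y. y)) (at x)"
    by (auto intro!: derivative_eq_intros)
  from has_derivative_compose[OF this f]
  have D: "((\<lambda>y. f (y + e)) has_derivative frechet_derivative f (at (x + e))) (at x)" .
  show "(\<lambda>y. f (y + e)) differentiable (at x)"
    by (rule differentiableI[OF D])
  show "partial_deriv i (\<lambda>y. f (y + e)) x = partial_deriv i f (x + e)"
    using partial_deriv_eqI[OF D] by (simp add: partial_deriv_def)
qed

lemma partial_deriv_periodic:
  assumes "\<And>x. f differentiable (at x)" "\<And>x. f (x + e) = f x"
  shows "partial_deriv i f (x + e) = partial_deriv i f x"
  using partial_deriv_shift[OF assms(1), where e = e and x = x and i = i] assms(2) by simp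

lemma constant_if_partial_derivs_zero:
  fixes f :: "real^'n::finite \<Rightarrow> 'b::real_normed_vector"
  assumes "\<And>x. f differentiable (at x)" "\<And>i x. partial_deriv i f x = 0"
  shows "f x = f y"
proof (rule has_derivative_zero_unique[of UNIV f])
  show "(f has_derivative (\<lambda>h. 0)) (at z within UNIV)" for z
  proof -
    have "frechet_derivative f (at z) = (\<lambda>h. 0)"
      using assms by (simp add: fun_eq_iff frechet_derivative_eq_sum_partial_deriv)
    then show ?thesis
      using assms(1)[of z] frechet_derivative_works[of f "at z"] by simp
  qed
qed auto

lemma constant_increment_if_partial_derivs_periodic:
  fixes f :: "real^'n::finite \<Rightarrow> 'b::real_normed_vector"
  assumes "\<And>x. f differentiable (at x)" "\<And>i x. partial_deriv i f (x + e) = partial_deriv i f x"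
  obtains k where "\<And>x. f (x + e) = f x + k"
proof -
  have "f (x + e) - f x = f (0 + e) - f 0" for x
    by (rule constant_if_partial_derivs_zero[where f = "\<lambda>x. f (x + e) - f x"])
      (simp_all add: assms differentiable_shift partial_deriv_diff partial_deriv_shift)
  then show ?thesis
    using that[of "f (0 + e) - f 0"] by (metis add_diff_cancel_left' diff_add_cancel add.commute)
qed

lemma has_vector_derivative_along_line:
  assumes "f differentiable (at (x + t *\<^sub>R w))"
  shows "((\<lambda>t. f (x + t *\<^sub>R w)) has_vector_derivative frechet_derivative f (at (x + t *\<^sub>R w)) w)
    (at t within S)"
proof -
  have f: "(f has_derivative frechet_derivative f (at (x + t *\<^sub>R w))) (at (x + t *\<^sub>R w))"
    using assms frechet_derivative_works by blast
  have line: "((\<lambda>t. x + t *\<^sub>R w) has_derivative (\<lambda>h. h *\<^sub>R w)) (at t within S)"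
    by (auto intro!: derivative_eq_intros)
  have "((\<lambda>t. f (x + t *\<^sub>R w)) has_derivative (\<lambda>h. frechet_derivative f (at (x + t *\<^sub>R w)) (h *\<^sub>R w)))
      (at t within S)"
    by (rule has_derivative_compose[OF line f])
  then show ?thesis
    by (simp add: has_vector_derivative_def linear_scale[OF linear_frechet_derivative[OF assms]])
qed

lemma integral_directional_derivative:
  fixes f :: "real^'n::finite \<Rightarrow> 'b::banach"
  assumes "class_C 1 f" "0 \<le> s"
  shows "integral {0..s} (\<lambda>t. frechet_derivative f (at (x + t *\<^sub>R w)) w) = f (x + s *\<^sub>R w) - f x"
  using assms unfolding class_C_1_iff
  by (subst integral_unique[OF fundamental_theorem_of_calculus[where f = "\<lambda>t. f (x + t *\<^sub>R w)"]])
    (auto intro: has_vector_derivative_along_line)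

text \<open>Symmetry of second derivatives. The fundamental theorem of calculus in direction \<open>i\<close> writes increments
  of \<open>f\<close> as integrals of \<open>\<partial>\<^sub>if\<close>; differentiating under the integral sign in direction \<open>j\<close> writes
  increments of \<open>\<partial>\<^sub>jf\<close> in direction \<open>i\<close> as integrals of \<open>\<partial>\<^sub>j\<partial>\<^sub>if\<close>, and differentiating these
  integrals in direction \<open>i\<close> gives the claim.\<close>

lemma partial_deriv_commute:
  fixes f :: "real^'n::finite \<Rightarrow> 'b::banach"
  assumes "class_C 2 f"
  shows "partial_deriv i (partial_deriv j f) x = partial_deriv j (partial_deriv i f) x"
proof -
  have C1: "class_C 1 f" "\<And>i. class_C 1 (partial_deriv i f)"
    using assms class_C_1_if_class_C_2 unfolding class_C_2_iff by auto
  have diff: "f differentiable (at y)" "partial_deriv i f differentiable (at y)" for i y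
    using C1 unfolding class_C_1_iff by auto
  have line: "((\<lambda>t. g (y + t *\<^sub>R axis k 1)) has_vector_derivative
      partial_deriv k g (y + t *\<^sub>R axis k 1)) (at t within S)"
    if "\<And>z. g differentiable (at z)" for g :: "real^'n \<Rightarrow> 'b" and y k t S
    unfolding partial_deriv_def by (rule has_vector_derivative_along_line[OF that])
  have ftc: "f (y + s *\<^sub>R axis i 1) =
      f y + integral {0..s} (\<lambda>r. partial_deriv i f (y + r *\<^sub>R axis i 1))" if "0 \<le> s" for y s
    using integral_directional_derivative[OF C1(1) that, of y "axis i 1"]
    unfolding partial_deriv_def by simp
  let ?H = "\<lambda>r t. partial_deriv i f (x + r *\<^sub>R axis i 1 + t *\<^sub>R axis j 1)"
  let ?H' = "\<lambda>r t. partial_deriv j (partial_deriv i f) (x + r *\<^sub>R axis i 1 + t *\<^sub>R axis j 1)"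
  have cont: "continuous_on S (\<lambda>z. partial_deriv k g (q z))"
    if "class_C 1 g" "continuous_on S q"
    for g :: "real^'n \<Rightarrow> 'b" and q :: "'c::topological_space \<Rightarrow> real^'n" and S k
    by (rule continuous_on_compose2[OF class_C_1_partial_deriv_continuous_on[OF that(1)] that(2)
      subset_UNIV])
  have first: "partial_deriv j f (x + s *\<^sub>R axis i 1)
      = partial_deriv j f x + integral {0..s} (\<lambda>r. ?H' r 0)" if s: "0 \<le> s" for s
  proof -
    have "((\<lambda>t. integral (cbox 0 s) (\<lambda>r. ?H r t)) has_vector_derivative
        integral (cbox 0 s) (\<lambda>r. ?H' r 0)) (at 0 within {0..1})"
      by (rule leibniz_rule_vector_derivative[where fx = "\<lambda>t r. ?H' r t"])
        (auto intro!: line diff integrable_continuous_real cont C1 continuous_intros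
          simp: case_prod_unfold)
    moreover have "((\<lambda>t. f (x + t *\<^sub>R axis j 1)) has_vector_derivative partial_deriv j f x)
        (at 0 within {0..1})"
      using line[OF diff(1), of x j 0] by simp
    ultimately have "((\<lambda>t. f (x + t *\<^sub>R axis j 1) + integral {0..s} (\<lambda>r. ?H r t))
        has_vector_derivative partial_deriv j f x + integral {0..s} (\<lambda>r. ?H' r 0))
        (at 0 within {0..1})"
      by (intro has_vector_derivative_add) auto
    moreover have "f (x + t *\<^sub>R axis j 1) + integral {0..s} (\<lambda>r. ?H r t)
        = f (x + s *\<^sub>R axis i 1 + t *\<^sub>R axis j 1)" for t
      using ftc[OF s, of "x + t *\<^sub>R axis j 1"] by (simp add: add_ac)
    ultimately have "((\<lambda>t. f (x + s *\<^sub>R axis i 1 + t *\<^sub>R axis j 1))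
        has_vector_derivative partial_deriv j f x + integral {0..s} (\<lambda>r. ?H' r 0))
        (at 0 within {0..1})"
      by simp
    moreover have "((\<lambda>t. f (x + s *\<^sub>R axis i 1 + t *\<^sub>R axis j 1)) has_vector_derivative
        partial_deriv j f (x + s *\<^sub>R axis i 1)) (at 0 within {0..1})"
      using line[OF diff(1), of "x + s *\<^sub>R axis i 1" j 0] by simp
    ultimately show ?thesis
      using vector_derivative_unique_within_closed_interval[of 0 1 0] by auto
  qed
  have "((\<lambda>s. integral {0..s} (\<lambda>r. ?H' r 0)) has_vector_derivative ?H' 0 0) (at 0 within {0..1})"
    by (rule integral_has_vector_derivative) (auto intro!: cont C1 continuous_intros)
  then have "((\<lambda>s. partial_deriv j f x + integral {0..s} (\<lambda>r. ?H' r 0))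
      has_vector_derivative ?H' 0 0) (at 0 within {0..1})"
    using has_vector_derivative_add[OF has_vector_derivative_const] by fastforce
  then have "((\<lambda>s. partial_deriv j f (x + s *\<^sub>R axis i 1)) has_vector_derivative ?H' 0 0)
      (at 0 within {0..1})"
    by (rule has_vector_derivative_transform[rotated 2]) (auto simp: first)
  moreover have "((\<lambda>s. partial_deriv j f (x + s *\<^sub>R axis i 1)) has_vector_derivative
      partial_deriv i (partial_deriv j f) x) (at 0 within {0..1})"
    using line[OF diff(2)[of j], of x i 0] by simp
  ultimately show ?thesis
    using vector_derivative_unique_within_closed_interval[of 0 1 0] by auto
qed

section \<open>Integration over a period cell\<close>

text \<open>The integral over the parallelogram with corner \<open>x\<close> and edges \<open>e1\<close>, \<open>e2\<close>, up to the constant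
  Jacobian. The corner is variable so that a conclusion about the corner of the cell is a conclusion
  about every point of the plane.\<close>

definition cell_integral ::
  "'a::real_normed_vector \<Rightarrow> 'a \<Rightarrow> 'a \<Rightarrow> ('a \<Rightarrow> real) \<Rightarrow> real" where
  "cell_integral e1 e2 x f =
    integral {0..1} (\<lambda>s. integral {0..1} (\<lambda>t. f (x + s *\<^sub>R e1 + t *\<^sub>R e2)))"

lemma continuous_on_cell:
  fixes f :: "'a::real_normed_vector \<Rightarrow> real"
  assumes "continuous_on UNIV f"
  shows "continuous_on S (\<lambda>t. f (x + s *\<^sub>R e1 + t *\<^sub>R e2))"
    and "continuous_on S (\<lambda>s. integral {0..1} (\<lambda>t. f (x + s *\<^sub>R e1 + t *\<^sub>R e2)))"
proof -
  have cont: "continuous_on T (\<lambda>z. f (q z))"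
    if "continuous_on T q" for q :: "'c::topological_space \<Rightarrow> 'a" and T
    by (rule continuous_on_compose2[OF assms that subset_UNIV])
  show "continuous_on S (\<lambda>t. f (x + s *\<^sub>R e1 + t *\<^sub>R e2))"
    by (intro cont continuous_intros)
  have "continuous_on S (\<lambda>s. integral (cbox 0 1) (\<lambda>t. f (x + s *\<^sub>R e1 + t *\<^sub>R e2)))"
    by (rule integral_continuous_on_param)
      (auto simp: case_prod_unfold intro!: cont continuous_intros)
  then show "continuous_on S (\<lambda>s. integral {0..1} (\<lambda>t. f (x + s *\<^sub>R e1 + t *\<^sub>R e2)))"
    by simp
qed

lemma cell_integral_add:
  assumes "continuous_on UNIV f" "continuous_on UNIV g"
  shows "cell_integral e1 e2 x (\<lambda>y. f y + g y) = cell_integral e1 e2 x f + cell_integral e1 e2 x g"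
  unfolding cell_integral_def
  by (simp add: integral_add integrable_continuous_real continuous_on_cell assms)

lemma cell_integral_mult_left:
  "cell_integral e1 e2 x (\<lambda>y. c * f y) = c * cell_integral e1 e2 x f"
  unfolding cell_integral_def by simp

lemma cell_integral_swap:
  assumes "continuous_on UNIV f"
  shows "cell_integral e1 e2 x f = cell_integral e2 e1 x f"
proof -
  have "continuous_on (cbox (0, 0) (1, 1)) (\<lambda>(s, t). f (x + s *\<^sub>R e1 + t *\<^sub>R e2))"
    unfolding case_prod_unfold
    by (rule continuous_on_compose2[OF assms _ subset_UNIV]) (intro continuous_intros)
  from integral_swap_continuous[OF this] show ?thesis
    unfolding cell_integral_def by (simp add: add_ac)
qed

lemma cell_integral_eq_0D:
  assumes cont: "continuous_on UNIV f" and nonneg: "\<And>y. 0 \<le> f y"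
    and "cell_integral e1 e2 x f = 0"
  shows "f x = 0"
proof -
  have "integral {0..1} (\<lambda>t. f (x + s *\<^sub>R e1 + t *\<^sub>R e2)) = 0" if "s \<in> {0..1}" for s
    using assms(3) that unfolding cell_integral_def
    by (subst (asm) integral_eq_0_iff)
      (auto intro!: continuous_on_cell cont nonneg integral_nonneg integrable_continuous_real)
  from this[of 0] have "integral {0..1} (\<lambda>t. f (x + t *\<^sub>R e2)) = 0"
    by simp
  moreover have "continuous_on {0..1} (\<lambda>t. f (x + t *\<^sub>R e2))"
    using continuous_on_cell(1)[OF cont, of _ x 0 e1 e2] by simp
  ultimately show ?thesis
    by (subst (asm) integral_eq_0_iff) (auto intro: nonneg dest: bspec[of _ _ 0])
qed

text \<open>Along an edge \<open>e\<close> of the cell, the inner integral of the derivative in direction \<open>e\<close> is the increment of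
  \<open>h\<close> over one period, whatever the position on the other edge.\<close>

lemma cell_integral_directional_derivative:
  fixes h :: "real^'n::finite \<Rightarrow> real"
  assumes C1: "class_C 1 h"
    and per: "\<And>x. h (x + e1) = h x + k1" "\<And>x. h (x + e2) = h x + k2"
  shows "cell_integral e1 e2 x (\<lambda>y. frechet_derivative h (at y) (\<alpha> *\<^sub>R e1 + \<beta> *\<^sub>R e2))
    = \<alpha> * k1 + \<beta> * k2"
proof -
  have along: "cell_integral a b x (\<lambda>y. frechet_derivative h (at y) b) = k"
    if "\<And>x. h (x + b) = h x + k" for a b k
    using integral_directional_derivative[OF C1, of 1 _ b] that
    unfolding cell_integral_def by simp
  have lin: "linear (frechet_derivative h (at y))" for y
    using C1 linear_frechet_derivative unfolding class_C_1_iff by blast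
  note cont = class_C_1_directional_continuous_on[OF C1]
  show ?thesis
    by (simp add: linear_add[OF lin] linear_scale[OF lin] cell_integral_add cell_integral_mult_left
        cont continuous_on_mult_left along[OF per(2)] cell_integral_swap[OF cont, of e1 e2 x e1]
        along[OF per(1)])
qed

lemma cell_integral_partial_deriv_periodic:
  fixes h :: "real^'n::finite \<Rightarrow> real"
  assumes "span {e1, e2} = UNIV" "class_C 1 h" "\<And>x. h (x + e1) = h x" "\<And>x. h (x + e2) = h x"
  shows "cell_integral e1 e2 x (partial_deriv i h) = 0"
proof -
  have "axis i 1 \<in> span {e1, e2}"
    using assms(1) by simp
  then obtain \<alpha> \<beta> where "axis i 1 = \<alpha> *\<^sub>R e1 + \<beta> *\<^sub>R e2"
    unfolding span_breakdown_eq by (auto simp: algebra_simps)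
  then show ?thesis
    using cell_integral_directional_derivative[OF assms(2), of e1 0 e2 0 x \<alpha> \<beta>] assms(3,4)
    unfolding partial_deriv_def[abs_def] by simp
qed

text \<open>When the gradient is periodic, \<open>p\<close> grows by constants \<open>k1\<close> and \<open>k2\<close> along \<open>e1\<close> and \<open>e2\<close>; these
  constants are the means of the derivatives of \<open>p\<close> in the directions \<open>e1\<close> and \<open>e2\<close>.\<close>

lemma periodic_if_mean_partial_derivs_zero:
  fixes p :: "real^'n::finite \<Rightarrow> real"
  assumes C1: "class_C 1 p"
    and per: "\<And>i x. partial_deriv i p (x + e1) = partial_deriv i p x"
      "\<And>i x. partial_deriv i p (x + e2) = partial_deriv i p x"
    and mean: "\<And>i. cell_integral e1 e2 0 (partial_deriv i p) = 0"
  shows "p (x + e1) = p x" "p (x + e2) = p x"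
proof -
  have diff: "p differentiable (at x)" for x
    using C1 unfolding class_C_1_iff by blast
  obtain k1 where k1: "\<And>x. p (x + e1) = p x + k1"
    using constant_increment_if_partial_derivs_periodic[OF diff per(1)] by blast
  obtain k2 where k2: "\<And>x. p (x + e2) = p x + k2"
    using constant_increment_if_partial_derivs_periodic[OF diff per(2)] by blast
  (* Finite additivity over the coordinates turns the zero means of the partial derivatives into
     zero means of all directional derivatives. *)
  have cell_sum: "cell_integral e1 e2 0 (\<lambda>y. \<Sum>i\<in>I. w $ i * partial_deriv i p y) = 0"
    if "finite I" for w and I :: "'n set"
    using that
  proof (induction I rule: finite_induct)
    case empty
    then show ?case by (simp add: cell_integral_def)
  next
    case (insert i I)
    then show ?case
      by (simp add: cell_integral_add cell_integral_mult_left mean continuous_on_sum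
          continuous_on_mult_left class_C_1_partial_deriv_continuous_on[OF C1])
  qed
  have "cell_integral e1 e2 0 (\<lambda>y. frechet_derivative p (at y) w) = 0" for w
    using cell_sum[of UNIV w] by (simp add: frechet_derivative_eq_sum_partial_deriv[OF diff])
  then have "\<alpha> * k1 + \<beta> * k2 = 0" for \<alpha> \<beta>
    using cell_integral_directional_derivative[OF C1 k1 k2] by metis
  from this[of 1 0] this[of 0 1] show "p (x + e1) = p x" "p (x + e2) = p x"
    using k1 k2 by simp_all
qed

section \<open>The angle of a nowhere vanishing plane field\<close>

text \<open>If \<open>v = \<bar>v\<bar> (cos \<phi>, sin \<phi>)\<close>, this is \<open>\<partial>\<^sub>i\<phi>\<close>. Unlike \<open>\<phi>\<close>, it involves no choice of branch.\<close>

definition angle_deriv :: "2 \<Rightarrow> (real^2 \<Rightarrow> real^2) \<Rightarrow> real^2 \<Rightarrow> real" where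
  "angle_deriv i v x =
    (v x $ 1 * partial_deriv i v x $ 2 - v x $ 2 * partial_deriv i v x $ 1)
      / (v x $ 1 * v x $ 1 + v x $ 2 * v x $ 2)"

lemma norm_square_2_neq_0: "(u :: real^2) \<noteq> 0 \<Longrightarrow> u $ 1 * u $ 1 + u $ 2 * u $ 2 \<noteq> 0"
  by (auto simp: vec_eq_iff forall_2 sum_squares_eq_zero_iff)

lemma class_C_1_angle_deriv:
  assumes C2: "class_C 2 v" and nz: "\<And>x. v x \<noteq> 0"
  shows "class_C 1 (angle_deriv i v)"
proof -
  have "class_C 1 (partial_deriv i v)"
    using C2 unfolding class_C_2_iff by blast
  then have "class_C 1 (\<lambda>x. partial_deriv i v x $ k)" for k
    by (rule class_C_1_component)
  moreover have "class_C 1 (\<lambda>x. v x $ k)" for k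
    by (rule class_C_1_component[OF class_C_1_if_class_C_2[OF C2]])
  ultimately show ?thesis
    unfolding angle_deriv_def[abs_def]
    by (intro class_C_1_divide class_C_1_diff class_C_1_add class_C_1_mult norm_square_2_neq_0 nz)
qed

text \<open>This is \<open>\<partial>\<^sub>1\<partial>\<^sub>2\<phi> = \<partial>\<^sub>2\<partial>\<^sub>1\<phi>\<close>, computed from the explicit quotient: the second derivatives of \<open>v\<close>
  cancel by symmetry, and what is left is a polynomial identity in \<open>v\<close> and its first derivatives.\<close>

lemma angle_deriv_curl_free:
  assumes C2: "class_C 2 v" and nz: "\<And>x. v x \<noteq> 0"
  shows "partial_deriv 1 (angle_deriv 2 v) x = partial_deriv 2 (angle_deriv 1 v) x"
proof -
  define n where "n = (\<lambda>x. v x $ 1 * v x $ 1 + v x $ 2 * v x $ 2)"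
  define A where "A = (\<lambda>i x. v x $ 1 * partial_deriv i v x $ 2 - v x $ 2 * partial_deriv i v x $ 1)"
  have diff: "v differentiable (at x)" "partial_deriv i v differentiable (at x)" for i
    using C2 unfolding class_C_2_iff class_C_1_iff by auto
  note diffs = diff[THEN differentiable_component]
  have n: "partial_deriv i n x = 2 * (v x $ 1 * partial_deriv i v x $ 1 + v x $ 2 * partial_deriv i v x $ 2)"
    "n differentiable (at x)" for i
    unfolding n_def
    by (simp_all add: partial_deriv_add partial_deriv_mult partial_deriv_component diff diffs)
  have A: "partial_deriv j (A i) x =
      partial_deriv j v x $ 1 * partial_deriv i v x $ 2
      + v x $ 1 * partial_deriv j (partial_deriv i v) x $ 2
      - (partial_deriv j v x $ 2 * partial_deriv i v x $ 1
      + v x $ 2 * partial_deriv j (partial_deriv i v) x $ 1)"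
    "A i differentiable (at x)" for i j
    unfolding A_def
    by (simp_all add: partial_deriv_diff partial_deriv_mult partial_deriv_component diff diffs)
  have quot: "partial_deriv j (angle_deriv i v) x
      = (partial_deriv j (A i) x * n x - A i x * partial_deriv j n x) / (n x * n x)" for i j
    using partial_deriv_divide[OF A(2) n(2), of j i] norm_square_2_neq_0[OF nz, of x]
    unfolding angle_deriv_def[abs_def] A_def n_def by simp
  have "partial_deriv 1 (A 2) x * n x - A 2 x * partial_deriv 1 n x
      = partial_deriv 2 (A 1) x * n x - A 1 x * partial_deriv 2 n x"
    unfolding A(1) n(1) partial_deriv_commute[OF C2, of 1 2 x]
    unfolding A_def n_def by algebra
  then show ?thesis
    unfolding quot by simp
qed

text \<open>When the angle is stationary, every derivative of \<open>v\<close> is parallel to \<open>v\<close>, so it only changes the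
  length of \<open>v\<close>.\<close>

lemma direction_constant_if_angle_deriv_zero:
  assumes diff: "\<And>x. v differentiable (at x)" and nz: "\<And>x. v x \<noteq> 0"
    and "\<And>i x. angle_deriv i v x = 0"
  shows "sgn (v x) = sgn (v y)"
proof (rule has_derivative_zero_unique[of UNIV "\<lambda>x. sgn (v x)"])
  fix z
  let ?D = "frechet_derivative v (at z)"
  have P: "v z $ 1 * partial_deriv i v z $ 2 = v z $ 2 * partial_deriv i v z $ 1" for i
    using assms(3)[of i z] norm_square_2_neq_0[OF nz, of z] unfolding angle_deriv_def
    by (metis divide_eq_0_iff eq_iff_diff_eq_0)
  have par: "v z $ 1 * ?D h $ 2 = v z $ 2 * ?D h $ 1" for h
    using P[of 1] P[of 2]
    by (simp add: frechet_derivative_eq_sum_partial_deriv[OF diff] sum_2 algebra_simps)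
  have D: "(v has_derivative ?D) (at z)"
    using diff frechet_derivative_works by blast
  (* The left-hand side is the derivative of v / |v| as the product rule yields it. *)
  have zero: "inverse (norm (v z)) *\<^sub>R ?D h
      - (inverse (norm (v z)) * (?D h \<bullet> sgn (v z)) * inverse (norm (v z))) *\<^sub>R v z = 0" for h
  proof -
    have D_eq: "(norm (v z))\<^sup>2 *\<^sub>R ?D h = (?D h \<bullet> v z) *\<^sub>R v z"
      using par[of h] unfolding power2_norm_eq_inner
      by (simp add: vec_eq_iff forall_2 inner_vec_def sum_2 algebra_simps)
    have "(inverse (norm (v z)) * (?D h \<bullet> sgn (v z)) * inverse (norm (v z))) *\<^sub>R v z
        = (inverse (norm (v z)))^3 *\<^sub>R (?D h \<bullet> v z) *\<^sub>R v z"
      by (simp add: sgn_div_norm power3_eq_cube)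
    also have "\<dots> = ((inverse (norm (v z)))^3 * (norm (v z))\<^sup>2) *\<^sub>R ?D h"
      by (simp only: D_eq[symmetric] scaleR_scaleR)
    also have "(inverse (norm (v z)))^3 * (norm (v z))\<^sup>2 = inverse (norm (v z))"
      using nz[of z] by (simp add: power3_eq_cube power2_eq_square field_simps)
    finally show ?thesis by simp
  qed
  have norm: "((\<lambda>x. norm (v x)) has_derivative (\<lambda>h. ?D h \<bullet> sgn (v z))) (at z)"
    by (rule has_derivative_compose[OF D has_derivative_norm[OF nz]])
  have "norm (v z) \<noteq> 0"
    using nz by simp
  from has_derivative_scaleR[OF Deriv.has_derivative_inverse[OF this norm] D] zero
  show "((\<lambda>x. sgn (v x)) has_derivative (\<lambda>h. 0)) (at z within UNIV)"
    by (simp add: sgn_div_norm)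
qed auto

section \<open>The pressure and the angle\<close>

lemma stationary_euler_2D:
  fixes v :: "real^2 \<Rightarrow> real^2"
  assumes "stationary_euler v p"
  shows "partial_deriv 1 v x $ 1 + partial_deriv 2 v x $ 2 = 0"
    and "v x $ 1 * partial_deriv 1 v x $ i + v x $ 2 * partial_deriv 2 v x $ i
      + partial_deriv i p x = 0"
proof -
  show "partial_deriv 1 v x $ 1 + partial_deriv 2 v x $ 2 = 0"
    using assms unfolding stationary_euler_def divergence_def by (simp add: sum_2)
  have "(convective v x + grad p x) $ i = 0"
    using assms unfolding stationary_euler_def by simp
  then show "v x $ 1 * partial_deriv 1 v x $ i + v x $ 2 * partial_deriv 2 v x $ i
      + partial_deriv i p x = 0"
    unfolding convective_def grad_def by (simp add: sum_2)
qed

text \<open>The reason is conservation of momentum: \<open>\<nabla>p = - div (v \<otimes> v)\<close> has mean zero over a period cell, so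
  \<open>p\<close> has no linear part.\<close>

lemma pressure_periodic:
  fixes v :: "real^2 \<Rightarrow> real^2"
  assumes euler: "stationary_euler v p" and C1v: "class_C 1 v" and C1p: "class_C 1 p"
    and span: "span {e1, e2} = UNIV"
    and per: "\<And>x. v (x + e1) = v x" "\<And>x. v (x + e2) = v x"
  shows "p (x + e1) = p x" "p (x + e2) = p x"
proof -
  have diff: "v differentiable (at x)" for x
    using C1v unfolding class_C_1_iff by blast
  have dp: "partial_deriv i p x =
      - (v x $ 1 * partial_deriv 1 v x $ i + v x $ 2 * partial_deriv 2 v x $ i)" for i x
    using stationary_euler_2D(2)[OF euler, of x i] by simp
  have C1: "class_C 1 (\<lambda>x. v x $ k * v x $ i)" for k i
    by (intro class_C_1_mult class_C_1_component C1v)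
  (* The extra term v_i div v in the divergence of v v_i vanishes. *)
  have tensor: "partial_deriv i p x = (-1) * partial_deriv 1 (\<lambda>x. v x $ 1 * v x $ i) x
      + (-1) * partial_deriv 2 (\<lambda>x. v x $ 2 * v x $ i) x" for i x
  proof -
    have "v x $ i * (partial_deriv 1 v x $ 1 + partial_deriv 2 v x $ 2) = 0"
      using stationary_euler_2D(1)[OF euler] by simp
    then show ?thesis
      using dp[of i x]
      by (simp add: partial_deriv_mult partial_deriv_component diff differentiable_component
          algebra_simps)
  qed
  have mean: "cell_integral e1 e2 0 (partial_deriv i p) = 0" for i
  proof -
    have "cell_integral e1 e2 0 (partial_deriv k (\<lambda>x. v x $ k * v x $ i)) = 0" for k
      by (rule cell_integral_partial_deriv_periodic[OF span C1]) (simp_all add: per)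
    moreover have "partial_deriv i p = (\<lambda>x. (-1) * partial_deriv 1 (\<lambda>x. v x $ 1 * v x $ i) x
        + (-1) * partial_deriv 2 (\<lambda>x. v x $ 2 * v x $ i) x)"
      using tensor by blast
    ultimately show ?thesis
      by (simp only: cell_integral_add cell_integral_mult_left continuous_on_mult_left
          class_C_1_partial_deriv_continuous_on[OF C1])
  qed
  have "partial_deriv i p (x + e1) = partial_deriv i p x"
    "partial_deriv i p (x + e2) = partial_deriv i p x" for i x
    by (simp_all add: dp per partial_deriv_periodic[OF diff])
  from periodic_if_mean_partial_derivs_zero[OF C1p this mean]
  show "p (x + e1) = p x" "p (x + e2) = p x" .
qed

text \<open>Replacing \<open>\<partial>\<^sub>2v\<^sub>2\<close> by \<open>-\<partial>\<^sub>1v\<^sub>1\<close> turns the numerators of the angle derivatives into the components of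
  \<open>v \<cdot> \<nabla>v\<close>, up to sign: the flow turns exactly as the rotated pressure gradient prescribes.\<close>

lemma angle_deriv_euler:
  fixes v :: "real^2 \<Rightarrow> real^2"
  assumes euler: "stationary_euler v p" and nz: "v x \<noteq> 0"
  shows "partial_deriv 1 p x = (v x $ 1 * v x $ 1 + v x $ 2 * v x $ 2) * angle_deriv 2 v x"
    and "partial_deriv 2 p x = - ((v x $ 1 * v x $ 1 + v x $ 2 * v x $ 2) * angle_deriv 1 v x)"
proof -
  have d: "partial_deriv 2 v x $ 2 = - partial_deriv 1 v x $ 1"
    using stationary_euler_2D(1)[OF euler, of x] by simp
  show "partial_deriv 1 p x = (v x $ 1 * v x $ 1 + v x $ 2 * v x $ 2) * angle_deriv 2 v x"
    using stationary_euler_2D(2)[OF euler, of x 1] norm_square_2_neq_0[OF nz]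
    by (simp add: angle_deriv_def d)
  show "partial_deriv 2 p x = - ((v x $ 1 * v x $ 1 + v x $ 2 * v x $ 2) * angle_deriv 1 v x)"
    using stationary_euler_2D(2)[OF euler, of x 2] norm_square_2_neq_0[OF nz]
    by (simp add: angle_deriv_def d)
qed

text \<open>The energy argument: the weighted Dirichlet energy \<open>\<bar>v\<bar>\<^sup>2 \<bar>\<nabla>\<phi>\<bar>\<^sup>2\<close> of the angle is the divergence of
  a periodic field, because it pairs a rotated gradient with a gradient. The integration by parts puts the
  derivatives on \<open>\<nabla>\<phi>\<close> and leaves \<open>p\<close> bare, which is legitimate since \<open>p\<close> and \<open>\<nabla>\<phi>\<close> are periodic even if
  \<open>\<phi>\<close> is not.\<close>

lemma angle_deriv_zero:
  fixes v :: "real^2 \<Rightarrow> real^2"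
  assumes euler: "stationary_euler v p" and C2: "class_C 2 v" and C1p: "class_C 1 p"
    and nz: "\<And>x. v x \<noteq> 0"
    and span: "span {e1, e2} = UNIV"
    and per: "\<And>x. v (x + e1) = v x" "\<And>x. v (x + e2) = v x"
  shows "angle_deriv i v x = 0"
proof -
  define g where "g = (\<lambda>i. angle_deriv i v)"
  define n where "n = (\<lambda>x. v x $ 1 * v x $ 1 + v x $ 2 * v x $ 2)"
  have C1v: "class_C 1 v"
    by (rule class_C_1_if_class_C_2[OF C2])
  have C1g: "class_C 1 (g i)" for i
    unfolding g_def by (rule class_C_1_angle_deriv[OF C2 nz])
  have diff: "v differentiable (at x)" "g i differentiable (at x)" "p differentiable (at x)" for i x
    using C1v C1g C1p unfolding class_C_1_iff by auto
  have gper: "g i (x + e1) = g i x" "g i (x + e2) = g i x" for i x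
    by (simp_all add: g_def angle_deriv_def per partial_deriv_periodic[OF diff(1)])
  note pper = pressure_periodic[OF euler C1v C1p span per]
  have C1pg: "class_C 1 (\<lambda>x. p x * g i x)" for i
    by (rule class_C_1_mult[OF C1p C1g])
  have energy: "n y * (g 1 y * g 1 y + g 2 y * g 2 y)
      = partial_deriv 1 (\<lambda>x. p x * g 2 x) y + (-1) * partial_deriv 2 (\<lambda>x. p x * g 1 x) y" for y
  proof -
    have "partial_deriv 1 p y = n y * g 2 y" "partial_deriv 2 p y = - (n y * g 1 y)"
      unfolding n_def g_def by (rule angle_deriv_euler[OF euler nz])+
    moreover have "partial_deriv 1 (g 2) y = partial_deriv 2 (g 1) y"
      unfolding g_def by (rule angle_deriv_curl_free[OF C2 nz])
    ultimately show ?thesis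
      by (simp add: partial_deriv_mult diff algebra_simps)
  qed
  have "cell_integral e1 e2 x (partial_deriv k (\<lambda>x. p x * g i x)) = 0" for i k
    by (rule cell_integral_partial_deriv_periodic[OF span C1pg]) (simp_all add: pper gper)
  then have mean: "cell_integral e1 e2 x (\<lambda>y. n y * (g 1 y * g 1 y + g 2 y * g 2 y)) = 0"
    unfolding energy
    by (simp only: cell_integral_add cell_integral_mult_left continuous_on_mult_left
        class_C_1_partial_deriv_continuous_on[OF C1pg])
  have cont: "continuous_on UNIV (\<lambda>y. n y * (g 1 y * g 1 y + g 2 y * g 2 y))"
    unfolding n_def by (intro continuous_intros class_C_1_continuous_on C1v C1g)
  have "n x * (g 1 x * g 1 x + g 2 x * g 2 x) = 0"
    by (rule cell_integral_eq_0D[OF cont _ mean]) (simp add: n_def)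
  moreover have "n x \<noteq> 0"
    unfolding n_def by (rule norm_square_2_neq_0[OF nz])
  ultimately have "g 1 x = 0 \<and> g 2 x = 0"
    by (simp add: sum_squares_eq_zero_iff)
  then show ?thesis
    unfolding g_def using exhaust_2[of i] by auto
qed

theorem corollary1p2:
  fixes v :: "real^2 \<Rightarrow> real^2" and p :: "real^2 \<Rightarrow> real"
  assumes "periodic_flow v"
    and "class_C 2 v"
    and "class_C 1 p"
    and "stationary_euler v p"
    and "\<forall>x. norm (v x) \<noteq> 0"
  shows "shear_flow v"
proof -
  obtain e1 e2 where span: "span {e1, e2} = UNIV"
    and lattice: "\<And>x (k1::int) (k2::int). v x = v (x + of_int k1 *\<^sub>R e1 + of_int k2 *\<^sub>R e2)"
    using assms(1) unfolding periodic_flow_def by blast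
  have per: "v (x + e1) = v x" "v (x + e2) = v x" for x
    using lattice[of x 1 0] lattice[of x 0 1] by simp_all
  have nz: "v x \<noteq> 0" for x
    using assms(5) by simp
  have diff: "v differentiable (at x)" for x
    using assms(2) unfolding class_C_2_iff by blast
  have "sgn (v x) = sgn (v 0)" for x
    by (rule direction_constant_if_angle_deriv_zero[OF diff nz
      angle_deriv_zero[OF assms(4,2,3) nz span per]])
  then have "v x = norm (v x) *\<^sub>R sgn (v 0)" for x
    using nz[of x] by (metis norm_eq_zero scaleR_scaleR sgn_div_norm right_inverse scaleR_one)
  moreover have "norm (sgn (v 0)) = 1"
    using nz by (simp add: norm_sgn)
  ultimately show ?thesis
    unfolding shear_flow_def by blast
qed

end
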